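(* Let $\Gamma$ be a graph and let $G \leq \mathrm{Aut}(\Gamma)$ be such that the quotient graph $\Gamma/G$ is connected. Then there exist functions $\zeta \colon D(\Gamma/G) \to G$ and $\omega \colon V(\Gamma/G) \cup D(\Gamma/G) \to S(G)$ such that $(\Gamma/G,G,\omega,\zeta)$ is a generalised voltage graph and $\Gamma$ is isomorphic to the associated generalised cover $\mathrm{GenCov}(\Gamma/G,G,\omega,\zeta)$.
   Context: Graphs. A graph is a quadruple $(V,D,\mathrm{beg},\mathrm{inv})$ where $V$ is a non-empty set of vertices, $D$ is a set of darts (disjoint from $V$), $\mathrm{beg}\colon D\to V$, and $\mathrm{inv}\colon D\to D$ satisfies $\mathrm{inv}\,\mathrm{inv}\,x=x$ for all $x\in D$. For $\Gamma=(V,D,\mathrm{beg},\mathrm{inv})$ write $V(\Gamma)=V$, $D(\Gamma)=D$, $\mathrm{beg}_\Gamma=\mathrm{beg}$, $\mathrm{inv}_\Gamma=\mathrm{inv}$; also $x^{-1}:=\mathrm{inv}\,x$ and $\mathrm{end}\,x:=\mathrm{beg}\,x^{-1}$ for a dart $x$. A walk is a sequence of darts $(x_1,\dots,x_n)$ with $\mathrm{end}\,x_i=\mathrm{beg}\,x_{i+1}$; a walk of length $0$ is regarded as a walk from any vertex $v$ to itself. A graph is connected if for any two vertices $u,v$ there is a walk from $u$ to $v$. A morphism $\Gamma\to\Delta$ is a function $V(\Gamma)\cup D(\Gamma)\to V(\Delta)\cup D(\Delta)$ mapping vertices to vertices and darts to darts and commuting with $\mathrm{beg}$ and $\mathrm{inv}$;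 an isomorphism is a bijective morphism; an automorphism is an isomorphism of a graph onto itself. $\mathrm{Aut}(\Gamma)$ acts on the right (image of $x$ under $g$ is $x^g$, and $x^{gh}=(x^g)^h$). Quotients. For $G\le \mathrm{Aut}(\Gamma)$, $x^G$ denotes the $G$-orbit of $x$, and $\Gamma/G$ is the graph whose vertices and darts are the $G$-orbits on $V(\Gamma)$ and on $D(\Gamma)$, with $\mathrm{beg}(x^G)=(\mathrm{beg}\,x)^G$ and $\mathrm{inv}(x^G)=(\mathrm{inv}\,x)^G$. Generalised voltage graphs. For a group $G$, $S(G)$ is the set of all subgroups of $G$, and $g^h:=h^{-1}gh$, $H^h:=h^{-1}Hh$. A generalised voltage graph is a quadruple $(\Delta,G,\omega,\zeta)$ where $\Delta$ is a connected graph, $G$ is a group, and $\omega\colon V(\Delta)\cup D(\Delta)\to S(G)$ and $\zeta\colon D(\Delta)\to G$ satisfy, for all $x\in D(\Delta)$: $\omega(x)\le\omega(\mathrm{beg}_\Delta x)$; $\omega(x)=\omega(x^{-1})^{\zeta(x)}$; and $\zeta(x^{-1})\zeta(x)\in\omega(x)$. Generalised cover. $\mathrm{GenCov}(\Delta,G,\omega,\zeta)$ is the graph $\Theta$ with $V(\Theta)=\{(v,\omega(v)g): v\in V(\Delta), g\in G\}$, $D(\Theta)=\{(x,\omega(x)g): x\in D(\Delta), g\in G\}$, $\mathrm{beg}_\Theta(x,\omega(x)g)=(\mathrm{beg}_\Delta x,\omega(\mathrm{beg}_\Delta x)g)$ and $\mathrm{inv}_\Theta(x,\omega(x)g)=(x^{-1},\omega(x^{-1})\zeta(x)g)$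 (here $\omega(x)g$ are right cosets). *)

theory Defs
  imports "HOL-Algebra.Coset"
begin

text \<open>Darts with \<open>dinv x = x\<close> (semi-edges), loops and parallel darts are all allowed.\<close>

record 'a pregraph =
  verts :: "'a set"
  darts :: "'a set"
  beg :: "'a \<Rightarrow> 'a"
  dinv :: "'a \<Rightarrow> 'a"

abbreviation elems :: "'a pregraph \<Rightarrow> 'a set"
  where "elems \<Gamma> \<equiv> verts \<Gamma> \<union> darts \<Gamma>"

locale graph =
  fixes \<Gamma> :: "'a pregraph"
  assumes verts_nonempty: "verts \<Gamma> \<noteq> {}"
    and verts_darts_disjoint: "verts \<Gamma> \<inter> darts \<Gamma> = {}"
    and beg_closed: "x \<in> darts \<Gamma> \<Longrightarrow> beg \<Gamma> x \<in> verts \<Gamma>"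
    and dinv_closed: "x \<in> darts \<Gamma> \<Longrightarrow> dinv \<Gamma> x \<in> darts \<Gamma>"
    and dinv_dinv: "x \<in> darts \<Gamma> \<Longrightarrow> dinv \<Gamma> (dinv \<Gamma> x) = x"

definition dend :: "'a pregraph \<Rightarrow> 'a \<Rightarrow> 'a"
  where "dend \<Gamma> x = beg \<Gamma> (dinv \<Gamma> x)"

definition walk :: "'a pregraph \<Rightarrow> 'a list \<Rightarrow> bool"
  where "walk \<Gamma> xs \<longleftrightarrow> set xs \<subseteq> darts \<Gamma> \<and> successively (\<lambda>x y. dend \<Gamma> x = beg \<Gamma> y) xs"

definition walk_betw :: "'a pregraph \<Rightarrow> 'a \<Rightarrow> 'a list \<Rightarrow> 'a \<Rightarrow> bool"
  where "walk_betw \<Gamma> u xs v \<longleftrightarrow> walk \<Gamma> xs \<and>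
    (if xs = [] then u = v else beg \<Gamma> (hd xs) = u \<and> dend \<Gamma> (last xs) = v)"

definition connected_graph :: "'a pregraph \<Rightarrow> bool"
  where "connected_graph \<Gamma> \<longleftrightarrow> (\<forall>u\<in>verts \<Gamma>. \<forall>v\<in>verts \<Gamma>. \<exists>xs. walk_betw \<Gamma> u xs v)"

definition graph_hom :: "'a pregraph \<Rightarrow> 'b pregraph \<Rightarrow> ('a \<Rightarrow> 'b) set"
  where "graph_hom \<Gamma> \<Delta> = {f. f ` verts \<Gamma> \<subseteq> verts \<Delta> \<and> f ` darts \<Gamma> \<subseteq> darts \<Delta> \<and>
    (\<forall>x\<in>darts \<Gamma>. f (beg \<Gamma> x) = beg \<Delta> (f x) \<and> f (dinv \<Gamma> x) = dinv \<Delta> (f x))}"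

definition graph_iso :: "'a pregraph \<Rightarrow> 'b pregraph \<Rightarrow> ('a \<Rightarrow> 'b) set"
  where "graph_iso \<Gamma> \<Delta> = {f \<in> graph_hom \<Gamma> \<Delta>. bij_betw f (elems \<Gamma>) (elems \<Delta>)}"

definition graph_isomorphic :: "'a pregraph \<Rightarrow> 'b pregraph \<Rightarrow> bool"
  where "graph_isomorphic \<Gamma> \<Delta> \<longleftrightarrow> graph_iso \<Gamma> \<Delta> \<noteq> {}"

text \<open>Automorphisms act on the right, \<open>x\<^sup>g\<close> being \<open>g x\<close>: the product of \<open>g\<close> and \<open>h\<close> is first
  \<open>g\<close>, then \<open>h\<close>, the opposite of the product in \<open>BijGroup\<close>. Automorphisms are taken to be
  extensional, so that they are determined by their values on the graph.\<close>

definition Aut :: "'a pregraph \<Rightarrow> ('a \<Rightarrow> 'a) monoid"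
  where "Aut \<Gamma> = \<lparr>carrier = graph_iso \<Gamma> \<Gamma> \<inter> extensional (elems \<Gamma>),
    mult = (\<lambda>g h. compose (elems \<Gamma>) h g), one = (\<lambda>x\<in>elems \<Gamma>. x)\<rparr>"

definition orb :: "('a \<Rightarrow> 'a) set \<Rightarrow> 'a \<Rightarrow> 'a set"
  where "orb G x = {g x |g. g \<in> G}"

text \<open>The images of an orbit \<open>x\<^sup>G\<close> under \<open>beg\<close> and \<open>dinv\<close> are the orbits of \<open>beg x\<close> and
  \<open>dinv x\<close>; see \<open>beg_quotient_graph\<close> and \<open>dinv_quotient_graph\<close> below.\<close>

definition quotient_graph :: "'a pregraph \<Rightarrow> ('a \<Rightarrow> 'a) set \<Rightarrow> 'a set pregraph"
  where "quotient_graph \<Gamma> G = \<lparr>verts = orb G ` verts \<Gamma>, darts = orb G ` darts \<Gamma>,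
    beg = (\<lambda>X. beg \<Gamma> ` X), dinv = (\<lambda>X. dinv \<Gamma> ` X)\<rparr>"

locale gen_voltage_graph = graph \<Delta> + group G
  for \<Delta> :: "'a pregraph" and G :: "('g, 'm) monoid_scheme" (structure)
    and \<omega> :: "'a \<Rightarrow> 'g set" and \<zeta> :: "'a \<Rightarrow> 'g" +
  assumes connected: "connected_graph \<Delta>"
    and omega_subgroup: "x \<in> elems \<Delta> \<Longrightarrow> subgroup (\<omega> x) G"
    and zeta_closed: "x \<in> darts \<Delta> \<Longrightarrow> \<zeta> x \<in> carrier G"
    and omega_beg: "x \<in> darts \<Delta> \<Longrightarrow> \<omega> x \<subseteq> \<omega> (beg \<Delta> x)"
    and omega_dinv: "x \<in> darts \<Delta> \<Longrightarrow> \<omega> x = inv (\<zeta> x) <# \<omega> (dinv \<Delta> x) #> \<zeta> x"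
    and zeta_dinv: "x \<in> darts \<Delta> \<Longrightarrow> \<zeta> (dinv \<Delta> x) \<otimes> \<zeta> x \<in> \<omega> x"

definition coset_rep :: "('g, 'm) monoid_scheme \<Rightarrow> 'g set \<Rightarrow> 'g set \<Rightarrow> 'g"
  where "coset_rep G H C = (SOME g. g \<in> carrier G \<and> C = H #>\<^bsub>G\<^esub> g)"

text \<open>\<open>beg\<close> and \<open>dinv\<close> do not depend on the choice of coset representatives; see
  \<open>beg_gen_cover\<close> and \<open>dinv_gen_cover\<close> below.\<close>

definition gen_cover ::
  "'a pregraph \<Rightarrow> ('g, 'm) monoid_scheme \<Rightarrow> ('a \<Rightarrow> 'g set) \<Rightarrow> ('a \<Rightarrow> 'g) \<Rightarrow> ('a \<times> 'g set) pregraph"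
  where "gen_cover \<Delta> G \<omega> \<zeta> = \<lparr>
    verts = {(v, \<omega> v #>\<^bsub>G\<^esub> g) |v g. v \<in> verts \<Delta> \<and> g \<in> carrier G},
    darts = {(x, \<omega> x #>\<^bsub>G\<^esub> g) |x g. x \<in> darts \<Delta> \<and> g \<in> carrier G},
    beg = (\<lambda>(x, C). (beg \<Delta> x, \<omega> (beg \<Delta> x) #>\<^bsub>G\<^esub> coset_rep G (\<omega> x) C)),
    dinv = (\<lambda>(x, C). (dinv \<Delta> x, \<omega> (dinv \<Delta> x) #>\<^bsub>G\<^esub> (\<zeta> x \<otimes>\<^bsub>G\<^esub> coset_rep G (\<omega> x) C)))\<rparr>"


lemma Aut_simps:
  "g \<in> carrier (Aut \<Gamma>) \<longleftrightarrow> g \<in> graph_iso \<Gamma> \<Gamma> \<and> g \<in> extensional (elems \<Gamma>)"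
  "g \<otimes>\<^bsub>Aut \<Gamma>\<^esub> h = compose (elems \<Gamma>) h g"
  "\<one>\<^bsub>Aut \<Gamma>\<^esub> = (\<lambda>x\<in>elems \<Gamma>. x)"
  by (auto simp: Aut_def)

context graph
begin

lemma graph_iso_compose:
  assumes "g \<in> graph_iso \<Gamma> \<Gamma>" "h \<in> graph_iso \<Gamma> \<Gamma>"
  shows "compose (elems \<Gamma>) h g \<in> graph_iso \<Gamma> \<Gamma>"
proof -
  have "bij_betw (compose (elems \<Gamma>) h g) (elems \<Gamma>) (elems \<Gamma>)"
    using assms by (auto simp: graph_iso_def intro: bij_betw_compose)
  then show ?thesis
    using assms beg_closed dinv_closed
    by (simp add: graph_iso_def graph_hom_def compose_def image_subset_iff)
qed

lemma graph_iso_restrict_id: "(\<lambda>x\<in>elems \<Gamma>. x) \<in> graph_iso \<Gamma> \<Gamma>"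
proof -
  have "bij_betw (\<lambda>x\<in>elems \<Gamma>. x) (elems \<Gamma>) (elems \<Gamma>)"
    by (auto simp: bij_betw_def inj_on_def)
  then show ?thesis
    using beg_closed dinv_closed by (auto simp: graph_iso_def graph_hom_def)
qed

lemma graph_iso_inv:
  assumes g: "g \<in> graph_iso \<Gamma> \<Gamma>"
  defines "h \<equiv> \<lambda>x\<in>elems \<Gamma>. inv_into (elems \<Gamma>) g x"
  shows "h \<in> graph_iso \<Gamma> \<Gamma>" and "compose (elems \<Gamma>) g h = (\<lambda>x\<in>elems \<Gamma>. x)"
proof -
  have b: "bij_betw g (elems \<Gamma>) (elems \<Gamma>)"
    and gV: "\<And>x. x \<in> verts \<Gamma> \<Longrightarrow> g x \<in> verts \<Gamma>" and gD: "\<And>x. x \<in> darts \<Gamma> \<Longrightarrow> g x \<in> darts \<Gamma>"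
    and gb: "\<And>x. x \<in> darts \<Gamma> \<Longrightarrow> g (beg \<Gamma> x) = beg \<Gamma> (g x)"
    and gi: "\<And>x. x \<in> darts \<Gamma> \<Longrightarrow> g (dinv \<Gamma> x) = dinv \<Gamma> (g x)"
    using g by (auto simp: graph_iso_def graph_hom_def)
  have hE: "h x \<in> elems \<Gamma>" and gh: "g (h x) = x" if "x \<in> elems \<Gamma>" for x
    using that b unfolding h_def bij_betw_def
    by (metis inv_into_into restrict_apply', metis f_inv_into_f restrict_apply')
  have hg: "h (g x) = x" if "x \<in> elems \<Gamma>" for x
    using that b gV gD unfolding h_def bij_betw_def
    by (metis Un_iff inv_into_f_f restrict_apply')
  have hV: "h x \<in> verts \<Gamma>" if "x \<in> verts \<Gamma>" for x
    using hE[of x] gh[of x] gD[of "h x"] that verts_darts_disjoint by auto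
  have hD: "h x \<in> darts \<Gamma>" if "x \<in> darts \<Gamma>" for x
    using hE[of x] gh[of x] gV[of "h x"] that verts_darts_disjoint by auto
  have hb: "h (beg \<Gamma> x) = beg \<Gamma> (h x)" if "x \<in> darts \<Gamma>" for x
    using gb[OF hD[OF that]] gh[of x] hg[of "beg \<Gamma> (h x)"] beg_closed[OF hD[OF that]] that by auto
  have hi: "h (dinv \<Gamma> x) = dinv \<Gamma> (h x)" if "x \<in> darts \<Gamma>" for x
    using gi[OF hD[OF that]] gh[of x] hg[of "dinv \<Gamma> (h x)"] dinv_closed[OF hD[OF that]] that by auto
  have "bij_betw h (elems \<Gamma>) (elems \<Gamma>)"
    using hE gh hg gV gD by (intro bij_betw_byWitness[where f' = g]) auto
  then show "h \<in> graph_iso \<Gamma> \<Gamma>"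
    using hV hD hb hi by (auto simp: graph_iso_def graph_hom_def)
  show "compose (elems \<Gamma>) g h = (\<lambda>x\<in>elems \<Gamma>. x)"
    using gh by (auto simp: compose_def restrict_def)
qed

lemma group_Aut: "group (Aut \<Gamma>)"
proof (rule groupI)
  fix g h k assume "g \<in> carrier (Aut \<Gamma>)" "h \<in> carrier (Aut \<Gamma>)" "k \<in> carrier (Aut \<Gamma>)"
  then show "g \<otimes>\<^bsub>Aut \<Gamma>\<^esub> h \<otimes>\<^bsub>Aut \<Gamma>\<^esub> k = g \<otimes>\<^bsub>Aut \<Gamma>\<^esub> (h \<otimes>\<^bsub>Aut \<Gamma>\<^esub> k)"
    by (fastforce simp: Aut_simps compose_def restrict_def graph_iso_def graph_hom_def)
next
  fix g assume g: "g \<in> carrier (Aut \<Gamma>)"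
  then show "\<one>\<^bsub>Aut \<Gamma>\<^esub> \<otimes>\<^bsub>Aut \<Gamma>\<^esub> g = g"
    by (auto simp: Aut_simps compose_def intro!: extensionalityI[where A = "elems \<Gamma>"])
  show "\<exists>h\<in>carrier (Aut \<Gamma>). h \<otimes>\<^bsub>Aut \<Gamma>\<^esub> g = \<one>\<^bsub>Aut \<Gamma>\<^esub>"
    using graph_iso_inv[of g] g
    by (intro bexI[of _ "\<lambda>x\<in>elems \<Gamma>. inv_into (elems \<Gamma>) g x"]) (auto simp: Aut_simps)
qed (auto simp: Aut_simps graph_iso_compose graph_iso_restrict_id)

lemma group_subgroup_Aut:
  assumes "subgroup G (Aut \<Gamma>)"
  shows "group (Aut \<Gamma>\<lparr>carrier := G\<rparr>)"
  using subgroup.subgroup_is_group[OF assms group_Aut] .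

lemma beg_quotient_graph:
  assumes "subgroup G (Aut \<Gamma>)" and "x \<in> darts \<Gamma>"
  shows "beg (quotient_graph \<Gamma> G) (orb G x) = orb G (beg \<Gamma> x)"
proof -
  have "\<And>g. g \<in> G \<Longrightarrow> g (beg \<Gamma> x) = beg \<Gamma> (g x)"
    using subgroup.subset[OF assms(1)] assms(2) by (auto simp: Aut_def graph_iso_def graph_hom_def)
  then show ?thesis by (fastforce simp: quotient_graph_def orb_def)
qed

lemma dinv_quotient_graph:
  assumes "subgroup G (Aut \<Gamma>)" and "x \<in> darts \<Gamma>"
  shows "dinv (quotient_graph \<Gamma> G) (orb G x) = orb G (dinv \<Gamma> x)"
proof -
  have "\<And>g. g \<in> G \<Longrightarrow> g (dinv \<Gamma> x) = dinv \<Gamma> (g x)"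
    using subgroup.subset[OF assms(1)] assms(2) by (auto simp: Aut_def graph_iso_def graph_hom_def)
  then show ?thesis by (fastforce simp: quotient_graph_def orb_def)
qed

lemma graph_quotient_graph:
  assumes "subgroup G (Aut \<Gamma>)"
  shows "graph (quotient_graph \<Gamma> G)"
proof
  have one: "(\<lambda>x\<in>elems \<Gamma>. x) \<in> G"
    using subgroup.one_closed[OF assms] by (simp add: Aut_simps)
  have orb_verts: "orb G v \<subseteq> verts \<Gamma>" if "v \<in> verts \<Gamma>" for v
    using that subgroup.subset[OF assms]
    by (fastforce simp: orb_def Aut_def graph_iso_def graph_hom_def)
  have orb_darts: "orb G x \<subseteq> darts \<Gamma>" if "x \<in> darts \<Gamma>" for x
    using that subgroup.subset[OF assms]
    by (fastforce simp: orb_def Aut_def graph_iso_def graph_hom_def)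
  have self: "x \<in> orb G x" if "x \<in> elems \<Gamma>" for x
    unfolding orb_def using one that by (auto intro!: exI[of _ "\<lambda>x\<in>elems \<Gamma>. x"])
  show "verts (quotient_graph \<Gamma> G) \<noteq> {}"
    using verts_nonempty by (auto simp: quotient_graph_def)
  show "verts (quotient_graph \<Gamma> G) \<inter> darts (quotient_graph \<Gamma> G) = {}"
  proof (rule ccontr)
    assume "\<not> ?thesis"
    then obtain v x where "v \<in> verts \<Gamma>" "x \<in> darts \<Gamma>" "orb G v = orb G x"
      by (auto simp: quotient_graph_def)
    then show False using self[of v] orb_darts[of x] verts_darts_disjoint by auto
  qed
  fix X assume "X \<in> darts (quotient_graph \<Gamma> G)"
  then obtain x where x: "x \<in> darts \<Gamma>" "X = orb G x" by (auto simp: quotient_graph_def)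
  show "beg (quotient_graph \<Gamma> G) X \<in> verts (quotient_graph \<Gamma> G)"
    using x beg_quotient_graph[OF assms x(1)] beg_closed[OF x(1)] by (auto simp: quotient_graph_def)
  show "dinv (quotient_graph \<Gamma> G) X \<in> darts (quotient_graph \<Gamma> G)"
    using x dinv_quotient_graph[OF assms x(1)] dinv_closed[OF x(1)] by (auto simp: quotient_graph_def)
  show "dinv (quotient_graph \<Gamma> G) (dinv (quotient_graph \<Gamma> G) X) = X"
    using x dinv_quotient_graph[OF assms] dinv_closed[OF x(1)] dinv_dinv[OF x(1)] by simp
qed

end

context gen_voltage_graph
begin

lemma coset_rep:
  assumes "subgroup H G" "g \<in> carrier G"
  obtains h where "h \<in> H" "coset_rep G H (H #> g) = h \<otimes> g"
proof -
  let ?r = "coset_rep G H (H #> g)"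
  have "?r \<in> carrier G \<and> H #> g = H #> ?r"
    unfolding coset_rep_def by (rule someI) (use assms in auto)
  then have "?r \<in> H #> g" using assms(1) rcos_self by auto
  then show thesis using that by (auto simp: r_coset_def)
qed

lemma r_coset_absorb:
  assumes "subgroup H G" "h \<in> H" "g \<in> carrier G"
  shows "H #> (h \<otimes> g) = H #> g"
  using assms by (metis coset_mult_assoc coset_join2 subgroup.mem_carrier subgroup.subset)

lemma beg_gen_cover:
  assumes "x \<in> darts \<Delta>" "g \<in> carrier G"
  shows "beg (gen_cover \<Delta> G \<omega> \<zeta>) (x, \<omega> x #> g) = (beg \<Delta> x, \<omega> (beg \<Delta> x) #> g)"
proof -
  obtain h where h: "h \<in> \<omega> x" "coset_rep G (\<omega> x) (\<omega> x #> g) = h \<otimes> g"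
    using coset_rep[of "\<omega> x" g] omega_subgroup[of x] assms by auto
  have "\<omega> (beg \<Delta> x) #> (h \<otimes> g) = \<omega> (beg \<Delta> x) #> g"
    using r_coset_absorb omega_subgroup beg_closed omega_beg h(1) assms by blast
  then show ?thesis using h(2) by (simp add: gen_cover_def)
qed

lemma dinv_gen_cover:
  assumes "x \<in> darts \<Delta>" "g \<in> carrier G"
  shows "dinv (gen_cover \<Delta> G \<omega> \<zeta>) (x, \<omega> x #> g) = (dinv \<Delta> x, \<omega> (dinv \<Delta> x) #> (\<zeta> x \<otimes> g))"
proof -
  obtain h where h: "h \<in> \<omega> x" "coset_rep G (\<omega> x) (\<omega> x #> g) = h \<otimes> g"
    using coset_rep[of "\<omega> x" g] omega_subgroup[of x] assms by auto
  have S: "subgroup (\<omega> (dinv \<Delta> x)) G" using omega_subgroup dinv_closed assms(1) by blast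
  have z: "\<zeta> x \<in> carrier G" using zeta_closed assms(1) .
  obtain k where k: "k \<in> \<omega> (dinv \<Delta> x)" "h = inv (\<zeta> x) \<otimes> k \<otimes> \<zeta> x"
    using h(1) omega_dinv[OF assms(1)] by (auto simp: r_coset_def l_coset_def)
  have kG: "k \<in> carrier G" using subgroup.mem_carrier[OF S k(1)] .
  have "\<zeta> x \<otimes> (h \<otimes> g) = k \<otimes> (\<zeta> x \<otimes> g)"
    using k(2) kG z assms(2) by (simp add: m_assoc inv_solve_left' flip: m_assoc)
  then have "\<omega> (dinv \<Delta> x) #> (\<zeta> x \<otimes> (h \<otimes> g)) = \<omega> (dinv \<Delta> x) #> (\<zeta> x \<otimes> g)"
    using r_coset_absorb[OF S k(1)] z assms(2) by simp
  then show ?thesis using h(2) by (simp add: gen_cover_def)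
qed

lemma graph_gen_cover: "graph (gen_cover \<Delta> G \<omega> \<zeta>)"
proof
  show "verts (gen_cover \<Delta> G \<omega> \<zeta>) \<noteq> {}"
    using verts_nonempty by (auto simp: gen_cover_def)
  show "verts (gen_cover \<Delta> G \<omega> \<zeta>) \<inter> darts (gen_cover \<Delta> G \<omega> \<zeta>) = {}"
    using verts_darts_disjoint by (auto simp: gen_cover_def)
  fix y assume "y \<in> darts (gen_cover \<Delta> G \<omega> \<zeta>)"
  then obtain x g where x: "x \<in> darts \<Delta>" "g \<in> carrier G" "y = (x, \<omega> x #> g)"
    by (auto simp: gen_cover_def)
  have z: "\<zeta> x \<in> carrier G" "\<zeta> (dinv \<Delta> x) \<in> carrier G"
    using zeta_closed dinv_closed x(1) by auto
  show "beg (gen_cover \<Delta> G \<omega> \<zeta>) y \<in> verts (gen_cover \<Delta> G \<omega> \<zeta>)"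
    unfolding x(3) beg_gen_cover[OF x(1,2)] using x(2) beg_closed[OF x(1)]
    by (auto simp: gen_cover_def)
  show "dinv (gen_cover \<Delta> G \<omega> \<zeta>) y \<in> darts (gen_cover \<Delta> G \<omega> \<zeta>)"
    unfolding x(3) dinv_gen_cover[OF x(1,2)] using x(2) z dinv_closed[OF x(1)]
    by (auto simp: gen_cover_def)
  have "\<omega> x #> (\<zeta> (dinv \<Delta> x) \<otimes> (\<zeta> x \<otimes> g)) = \<omega> x #> g"
    using r_coset_absorb[OF _ zeta_dinv[OF x(1)] x(2)] omega_subgroup[of x] x z
    by (simp add: m_assoc)
  then show "dinv (gen_cover \<Delta> G \<omega> \<zeta>) (dinv (gen_cover \<Delta> G \<omega> \<zeta>) y) = y"
    using x z dinv_closed[OF x(1)] dinv_dinv[OF x(1)] by (simp add: dinv_gen_cover)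
qed

end

end

theory Submission
  imports Defs
begin

text \<open>Choose a representative \<open>\<tau> X\<close> of every orbit \<open>X\<close> so that representatives of dart orbits begin at
  representatives of vertex orbits. Let \<open>\<omega> X\<close> be the stabiliser of \<open>\<tau> X\<close>, and let \<open>\<zeta> X\<close> carry
  \<open>\<tau> (X\<^sup>-\<^sup>1)\<close> to \<open>(\<tau> X)\<^sup>-\<^sup>1\<close>. The right coset \<open>\<omega> X g\<close> then consists of the elements of \<open>G\<close>
  which carry \<open>\<tau> X\<close> to \<open>(\<tau> X)\<^sup>g\<close>, so \<open>(\<tau> X)\<^sup>g \<mapsto> (X, \<omega> X g)\<close> identifies the graph with the cover.\<close>

section \<open>Right action of a group of automorphisms on a graph\<close>

locale graph_action = graph \<Gamma> for \<Gamma> :: "'a pregraph" +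
  fixes G :: "('a \<Rightarrow> 'a) set"
  assumes subgroup: "subgroup G (Aut \<Gamma>)"
begin

abbreviation A where "A \<equiv> Aut \<Gamma>\<lparr>carrier := G\<rparr>"
abbreviation Q where "Q \<equiv> quotient_graph \<Gamma> G"

sublocale A: group A
  using group_subgroup_Aut[OF subgroup] .

sublocale Q: graph Q
  using graph_quotient_graph[OF subgroup] .

lemma
  assumes "g \<in> G"
  shows act_verts: "v \<in> verts \<Gamma> \<Longrightarrow> g v \<in> verts \<Gamma>"
    and act_darts: "x \<in> darts \<Gamma> \<Longrightarrow> g x \<in> darts \<Gamma>"
    and act_beg: "x \<in> darts \<Gamma> \<Longrightarrow> g (beg \<Gamma> x) = beg \<Gamma> (g x)"
    and act_dinv: "x \<in> darts \<Gamma> \<Longrightarrow> g (dinv \<Gamma> x) = dinv \<Gamma> (g x)"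
  using subsetD[OF subgroup.subset[OF subgroup] assms]
  by (auto simp: Aut_def graph_iso_def graph_hom_def)

lemma act_elems: "g \<in> G \<Longrightarrow> x \<in> elems \<Gamma> \<Longrightarrow> g x \<in> elems \<Gamma>"
  using act_verts act_darts by blast

lemma act_one: "x \<in> elems \<Gamma> \<Longrightarrow> \<one>\<^bsub>A\<^esub> x = x"
  by (auto simp: Aut_simps)

lemma act_mult: "x \<in> elems \<Gamma> \<Longrightarrow> (g \<otimes>\<^bsub>A\<^esub> h) x = h (g x)"
  by (auto simp: Aut_simps compose_def)

lemma mult_closed: "g \<in> G \<Longrightarrow> h \<in> G \<Longrightarrow> g \<otimes>\<^bsub>A\<^esub> h \<in> G"
  using A.m_closed[of g h] by simp

lemma inv_closed: "g \<in> G \<Longrightarrow> inv\<^bsub>A\<^esub> g \<in> G"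
  using A.inv_closed[of g] by simp

lemma one_closed: "\<one>\<^bsub>A\<^esub> \<in> G"
  using A.one_closed by simp

lemma act_inv_act: "g \<in> G \<Longrightarrow> x \<in> elems \<Gamma> \<Longrightarrow> (inv\<^bsub>A\<^esub> g) (g x) = x"
  using act_mult[of x g "inv\<^bsub>A\<^esub> g"] act_one[of x] A.r_inv[of g] by simp

lemma orb_memI: "g \<in> G \<Longrightarrow> g x \<in> orb G x"
  by (auto simp: orb_def)

lemma orb_self: "x \<in> elems \<Gamma> \<Longrightarrow> x \<in> orb G x"
  using orb_memI[OF one_closed] act_one by metis

lemma orb_act_subset: "g \<in> G \<Longrightarrow> x \<in> elems \<Gamma> \<Longrightarrow> orb G (g x) \<subseteq> orb G x"
  using mult_closed act_mult unfolding orb_def subset_iff mem_Collect_eq by metis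

text \<open>The converse inclusion is \<open>orb_act_subset\<close> for the inverse of
  \<open>g\<close> at the point \<open>g x\<close>.\<close>

lemma orb_act:
  assumes "g \<in> G" "x \<in> elems \<Gamma>"
  shows "orb G (g x) = orb G x"
  using orb_act_subset[OF assms] orb_act_subset[OF inv_closed act_elems, OF assms(1) assms]
    act_inv_act[OF assms] by simp

section \<open>Transporters as cosets of stabilisers\<close>

text \<open>Covers two notions at once: stabilisers (\<open>x = y\<close>) and, for points in one
  orbit, the right cosets of the stabiliser of \<open>x\<close>.\<close>

definition transporter :: "'a \<Rightarrow> 'a \<Rightarrow> ('a \<Rightarrow> 'a) set"
  where "transporter x y = {g \<in> G. g x = y}"

text \<open>A factor on the right acts last, so it moves the target; cancelling \<open>g\<close>
  gives the converse inclusion.\<close>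

lemma transporter_r_coset:
  assumes "x \<in> elems \<Gamma>" "y \<in> elems \<Gamma>" "g \<in> G"
  shows "transporter x y #>\<^bsub>A\<^esub> g = transporter x (g y)"
proof (intro equalityI subsetI)
  fix k assume "k \<in> transporter x y #>\<^bsub>A\<^esub> g"
  then obtain h where "h \<in> G" "h x = y" "k = h \<otimes>\<^bsub>A\<^esub> g"
    by (auto simp: r_coset_def transporter_def)
  then show "k \<in> transporter x (g y)"
    using assms mult_closed[of h g] act_mult[of x h g] by (simp add: transporter_def)
next
  fix k assume "k \<in> transporter x (g y)"
  then have k: "k \<in> G" "k x = g y" by (auto simp: transporter_def)
  have "k \<otimes>\<^bsub>A\<^esub> inv\<^bsub>A\<^esub> g \<in> transporter x y"
    using k assms mult_closed[OF k(1) inv_closed] act_mult[of x k] act_inv_act[of g y]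
    by (simp add: transporter_def)
  moreover have "k = k \<otimes>\<^bsub>A\<^esub> inv\<^bsub>A\<^esub> g \<otimes>\<^bsub>A\<^esub> g"
    using A.inv_solve_right[of "k \<otimes>\<^bsub>A\<^esub> inv\<^bsub>A\<^esub> g" k g] k(1) assms(3) mult_closed[OF k(1) inv_closed]
    by simp
  ultimately show "k \<in> transporter x y #>\<^bsub>A\<^esub> g"
    unfolding r_coset_def by blast
qed

text \<open>A factor on the left acts first, so it moves the source. Together with the rule for
  right cosets this computes conjugates of stabilisers.\<close>

lemma transporter_l_coset:
  assumes "x \<in> elems \<Gamma>" "g \<in> G"
  shows "inv\<^bsub>A\<^esub> g <#\<^bsub>A\<^esub> transporter x y = transporter (g x) y"
proof (intro equalityI subsetI)
  fix k assume "k \<in> inv\<^bsub>A\<^esub> g <#\<^bsub>A\<^esub> transporter x y"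
  then obtain h where "h \<in> G" "h x = y" "k = inv\<^bsub>A\<^esub> g \<otimes>\<^bsub>A\<^esub> h"
    by (auto simp: l_coset_def transporter_def)
  then show "k \<in> transporter (g x) y"
    using assms mult_closed[OF inv_closed, of g h] act_mult[OF act_elems, of g x "inv\<^bsub>A\<^esub> g" h]
      act_inv_act[of g x] by (simp add: transporter_def)
next
  fix k assume "k \<in> transporter (g x) y"
  then have k: "k \<in> G" "k (g x) = y" by (auto simp: transporter_def)
  have "g \<otimes>\<^bsub>A\<^esub> k \<in> transporter x y"
    using k assms mult_closed[of g k] act_mult[of x g k] by (simp add: transporter_def)
  moreover have "k = inv\<^bsub>A\<^esub> g \<otimes>\<^bsub>A\<^esub> (g \<otimes>\<^bsub>A\<^esub> k)"
    using A.inv_solve_left[of k g "g \<otimes>\<^bsub>A\<^esub> k"] k(1) assms(2) mult_closed[of g k] by simp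
  ultimately show "k \<in> inv\<^bsub>A\<^esub> g <#\<^bsub>A\<^esub> transporter x y"
    unfolding l_coset_def by blast
qed

lemma subgroup_stabiliser:
  assumes "x \<in> elems \<Gamma>"
  shows "subgroup (transporter x x) A"
proof (rule A.subgroupI)
  show "transporter x x \<noteq> {}"
    using one_closed act_one[OF assms] by (auto simp: transporter_def)
next
  fix g assume "g \<in> transporter x x"
  then show "inv\<^bsub>A\<^esub> g \<in> transporter x x"
    using inv_closed[of g] act_inv_act[of g x] assms by (auto simp: transporter_def)
next
  fix g h assume "g \<in> transporter x x" "h \<in> transporter x x"
  then show "g \<otimes>\<^bsub>A\<^esub> h \<in> transporter x x"
    using mult_closed[of g h] act_mult[OF assms, of g h] by (auto simp: transporter_def)
qed (auto simp: transporter_def)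

end

section \<open>Orbit representatives and the voltages they define\<close>

text \<open>Compatibility is asked for \<open>beg\<close> only: the inverse of a representative dart
  may fail to be a representative, and \<open>\<zeta>\<close> records the discrepancy.\<close>

locale orbit_representatives = graph_action +
  fixes \<tau> :: "'a set \<Rightarrow> 'a"
  assumes rep_in: "X \<in> elems Q \<Longrightarrow> \<tau> X \<in> X"
    and beg_rep: "X \<in> darts Q \<Longrightarrow> beg \<Gamma> (\<tau> X) = \<tau> (beg Q X)"
begin

lemma
  shows rep_verts: "X \<in> verts Q \<Longrightarrow> \<tau> X \<in> verts \<Gamma>"
    and rep_darts: "X \<in> darts Q \<Longrightarrow> \<tau> X \<in> darts \<Gamma>"
  using rep_in[of X] act_verts act_darts by (auto simp: quotient_graph_def orb_def)

lemma rep_elems: "X \<in> elems Q \<Longrightarrow> \<tau> X \<in> elems \<Gamma>"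
  using rep_verts rep_darts by blast

lemma orb_rep:
  assumes "X \<in> elems Q"
  shows "orb G (\<tau> X) = X"
proof -
  obtain x where "x \<in> elems \<Gamma>" "X = orb G x"
    using assms by (auto simp: quotient_graph_def)
  moreover from this obtain g where "g \<in> G" "\<tau> X = g x"
    using rep_in[OF assms] by (auto simp: orb_def)
  ultimately show ?thesis using orb_act by simp
qed

lemma orb_in_elems: "x \<in> elems \<Gamma> \<Longrightarrow> orb G x \<in> elems Q"
  by (auto simp: quotient_graph_def)

lemma rep_transport:
  assumes "x \<in> elems \<Gamma>"
  obtains g where "g \<in> G" "g (\<tau> (orb G x)) = x"
  using orb_self[OF assms] orb_rep[OF orb_in_elems[OF assms]] that by (force simp: orb_def)

definition \<omega> :: "'a set \<Rightarrow> ('a \<Rightarrow> 'a) set"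
  where "\<omega> X = transporter (\<tau> X) (\<tau> X)"

text \<open>Any element of the transporter serves. No relation between the values at a dart orbit
  and at its inverse is imposed; \<open>\<omega>\<close> absorbs the ambiguity.\<close>

definition \<zeta> :: "'a set \<Rightarrow> 'a \<Rightarrow> 'a"
  where "\<zeta> X = (SOME g. g \<in> transporter (\<tau> (dinv Q X)) (dinv \<Gamma> (\<tau> X)))"

text \<open>The orbit of the inverse of \<open>\<tau> X\<close> is \<open>dinv Q X\<close>, so the
  transporter from which \<open>\<zeta> X\<close> is chosen is not empty.\<close>

lemma
  assumes "X \<in> darts Q"
  shows zeta_in: "\<zeta> X \<in> G" and zeta_rep: "\<zeta> X (\<tau> (dinv Q X)) = dinv \<Gamma> (\<tau> X)"
proof -
  have X: "orb G (\<tau> X) = X" "\<tau> X \<in> darts \<Gamma>"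
    using assms orb_rep rep_darts by auto
  have "orb G (dinv \<Gamma> (\<tau> X)) = dinv Q X"
    using dinv_quotient_graph[OF subgroup X(2)] X(1) by simp
  then obtain g where "g \<in> G" "g (\<tau> (dinv Q X)) = dinv \<Gamma> (\<tau> X)"
    using rep_transport[of "dinv \<Gamma> (\<tau> X)"] dinv_closed[OF X(2)] by auto
  then have "\<exists>g. g \<in> transporter (\<tau> (dinv Q X)) (dinv \<Gamma> (\<tau> X))"
    by (auto simp: transporter_def)
  then have "\<zeta> X \<in> transporter (\<tau> (dinv Q X)) (dinv \<Gamma> (\<tau> X))"
    unfolding \<zeta>_def by (rule someI_ex)
  then show "\<zeta> X \<in> G" "\<zeta> X (\<tau> (dinv Q X)) = dinv \<Gamma> (\<tau> X)"
    by (auto simp: transporter_def)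
qed

lemma omega_r_coset:
  assumes "X \<in> elems Q" "g \<in> G"
  shows "\<omega> X #>\<^bsub>A\<^esub> g = transporter (\<tau> X) (g (\<tau> X))"
  using transporter_r_coset rep_elems assms by (simp add: \<omega>_def)

lemma gen_voltage_graph_quotient:
  assumes "connected_graph Q"
  shows "gen_voltage_graph Q A \<omega> \<zeta>"
proof (intro gen_voltage_graph.intro gen_voltage_graph_axioms.intro Q.graph_axioms A.group_axioms)
  show "connected_graph Q" by fact
  show "subgroup (\<omega> X) A" if "X \<in> elems Q" for X
    using subgroup_stabiliser[OF rep_elems[OF that]] by (simp add: \<omega>_def)
  fix X assume X: "X \<in> darts Q"
  let ?Y = "dinv Q X"
  have Y: "?Y \<in> darts Q" using Q.dinv_closed[OF X] .
  have t: "\<tau> X \<in> darts \<Gamma>" "\<tau> ?Y \<in> darts \<Gamma>" using rep_darts X Y by auto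
  show "\<zeta> X \<in> carrier A" using zeta_in[OF X] by simp
  \<comment> \<open>An automorphism fixing a dart fixes its beginning, and \<open>\<tau> X\<close>
    begins at a representative.\<close>
  show "\<omega> X \<subseteq> \<omega> (beg Q X)"
  proof
    fix g assume "g \<in> \<omega> X"
    then show "g \<in> \<omega> (beg Q X)"
      using act_beg[of g, OF _ t(1)] beg_rep[OF X] by (simp add: \<omega>_def transporter_def)
  qed
  \<comment> \<open>The left factor moves the source and the right factor the target, both from
    \<open>\<tau> ?Y\<close> to the inverse of \<open>\<tau> X\<close>.\<close>
  have "inv\<^bsub>A\<^esub> (\<zeta> X) <#\<^bsub>A\<^esub> \<omega> ?Y #>\<^bsub>A\<^esub> \<zeta> X = transporter (dinv \<Gamma> (\<tau> X)) (dinv \<Gamma> (\<tau> X))"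
    using t zeta_in[OF X] zeta_rep[OF X] dinv_closed[OF t(1)]
      transporter_l_coset[of "\<tau> ?Y" "\<zeta> X" "\<tau> ?Y"] transporter_r_coset[of "dinv \<Gamma> (\<tau> X)" "\<tau> ?Y" "\<zeta> X"]
    by (simp add: \<omega>_def)
  also have "\<dots> = \<omega> X"
  proof -
    \<comment> \<open>A dart and its inverse have the same stabiliser, since automorphisms commute
      with the involution.\<close>
    have "g (dinv \<Gamma> (\<tau> X)) = dinv \<Gamma> (\<tau> X) \<longleftrightarrow> g (\<tau> X) = \<tau> X" if "g \<in> G" for g
      using act_dinv[OF that t(1)] dinv_dinv[OF t(1)] dinv_dinv[OF act_darts[OF that t(1)]] by metis
    then show ?thesis by (auto simp: \<omega>_def transporter_def)
  qed
  finally show "\<omega> X = inv\<^bsub>A\<^esub> (\<zeta> X) <#\<^bsub>A\<^esub> \<omega> ?Y #>\<^bsub>A\<^esub> \<zeta> X" by simp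
  \<comment> \<open>Since \<open>dinv Q ?Y = X\<close>, the element \<open>\<zeta> ?Y\<close> acts
    on \<open>\<tau> X\<close> itself.\<close>
  have "(\<zeta> ?Y \<otimes>\<^bsub>A\<^esub> \<zeta> X) (\<tau> X) = \<zeta> X (dinv \<Gamma> (\<tau> ?Y))"
    using act_mult[of "\<tau> X" "\<zeta> ?Y" "\<zeta> X"] t(1) zeta_rep[OF Y] Q.dinv_dinv[OF X] by simp
  also have "\<dots> = \<tau> X"
    using act_dinv[OF zeta_in[OF X] t(2)] zeta_rep[OF X] dinv_dinv[OF t(1)] by simp
  finally show "\<zeta> ?Y \<otimes>\<^bsub>A\<^esub> \<zeta> X \<in> \<omega> X"
    using mult_closed[OF zeta_in[OF Y] zeta_in[OF X]] by (simp add: \<omega>_def transporter_def)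
qed

section \<open>The isomorphism onto the generalised cover\<close>

text \<open>Writing the coset as a transporter avoids choosing a \<open>g\<close> that carries the
  representative to \<open>x\<close>, so nothing has to be shown well defined.\<close>

definition cover_map :: "'a \<Rightarrow> 'a set \<times> ('a \<Rightarrow> 'a) set"
  where "cover_map x = (orb G x, transporter (\<tau> (orb G x)) x)"

lemma cover_map_act_rep:
  assumes "X \<in> elems Q" "g \<in> G"
  shows "cover_map (g (\<tau> X)) = (X, \<omega> X #>\<^bsub>A\<^esub> g)"
  unfolding cover_map_def omega_r_coset[OF assms]
  using orb_act[OF assms(2) rep_elems[OF assms(1)]] orb_rep[OF assms(1)] by simp

text \<open>This form matches the comprehensions in \<open>gen_cover\<close>, which makes
  surjectivity of \<open>cover_map\<close> a rewriting step.\<close>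

lemma elems_eq_act_rep:
  shows "verts \<Gamma> = {g (\<tau> X) |X g. X \<in> verts Q \<and> g \<in> G}"
    and "darts \<Gamma> = {g (\<tau> X) |X g. X \<in> darts Q \<and> g \<in> G}"
proof -
  have *: "S = {g (\<tau> X) |X g. X \<in> orb G ` S \<and> g \<in> G}"
    if S: "S \<subseteq> elems \<Gamma>" and act: "\<And>g x. g \<in> G \<Longrightarrow> x \<in> S \<Longrightarrow> g x \<in> S" for S
  proof (intro equalityI subsetI)
    fix x assume x: "x \<in> S"
    then obtain g where "g \<in> G" "g (\<tau> (orb G x)) = x"
      using rep_transport[of x] S by blast
    then show "x \<in> {g (\<tau> X) |X g. X \<in> orb G ` S \<and> g \<in> G}"
      unfolding mem_Collect_eq using x by (metis imageI)
  next
    fix y assume "y \<in> {g (\<tau> X) |X g. X \<in> orb G ` S \<and> g \<in> G}"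
    then obtain x g where "x \<in> S" "g \<in> G" "y = g (\<tau> (orb G x))" by blast
    moreover from this obtain h where "h \<in> G" "\<tau> (orb G x) = h x"
      using rep_in[OF orb_in_elems, of x] S by (auto simp: orb_def)
    ultimately show "y \<in> S" using act by simp
  qed
  show "verts \<Gamma> = {g (\<tau> X) |X g. X \<in> verts Q \<and> g \<in> G}"
    using *[of "verts \<Gamma>"] act_verts by (simp add: quotient_graph_def)
  show "darts \<Gamma> = {g (\<tau> X) |X g. X \<in> darts Q \<and> g \<in> G}"
    using *[of "darts \<Gamma>"] act_darts by (simp add: quotient_graph_def)
qed

lemma cover_map_iso:
  assumes "connected_graph Q"
  shows "cover_map \<in> graph_iso \<Gamma> (gen_cover Q A \<omega> \<zeta>)" (is "_ \<in> graph_iso \<Gamma> ?C")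
proof -
  interpret V: gen_voltage_graph Q A \<omega> \<zeta>
    using gen_voltage_graph_quotient[OF assms] .
  have V: "cover_map ` verts \<Gamma> = verts ?C"
  proof -
    have "cover_map ` verts \<Gamma> = {cover_map (g (\<tau> X)) |X g. X \<in> verts Q \<and> g \<in> G}"
      unfolding elems_eq_act_rep(1) by blast
    also have "\<dots> = verts ?C"
      \<comment> \<open>The congruence rule makes \<open>X \<in> verts Q\<close> and
        \<open>g \<in> G\<close> available while the equation before them is rewritten.\<close>
      by (simp add: gen_cover_def cover_map_act_rep cong: rev_conj_cong)
    finally show ?thesis .
  qed
  have D: "cover_map ` darts \<Gamma> = darts ?C"
  proof -
    have "cover_map ` darts \<Gamma> = {cover_map (g (\<tau> X)) |X g. X \<in> darts Q \<and> g \<in> G}"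
      unfolding elems_eq_act_rep(2) by blast
    also have "\<dots> = darts ?C"
      by (simp add: gen_cover_def cover_map_act_rep cong: rev_conj_cong)
    finally show ?thesis .
  qed
  have "inj_on cover_map (elems \<Gamma>)"
  proof (rule inj_onI)
    fix x y assume x: "x \<in> elems \<Gamma>" and "cover_map x = cover_map y"
    then have eq: "orb G x = orb G y" "transporter (\<tau> (orb G x)) x = transporter (\<tau> (orb G y)) y"
      by (auto simp: cover_map_def)
    \<comment> \<open>Transporters from a representative to a point of its orbit are not empty, and
      any one member determines the target.\<close>
    obtain g where "g \<in> transporter (\<tau> (orb G x)) x"
      using rep_transport[OF x] by (auto simp: transporter_def)
    then show "x = y" using eq by (auto simp: transporter_def)
  qed
  then have "bij_betw cover_map (elems \<Gamma>) (elems ?C)"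
    using V D by (auto simp: bij_betw_def image_Un)
  moreover have "cover_map (beg \<Gamma> x) = beg ?C (cover_map x) \<and>
      cover_map (dinv \<Gamma> x) = dinv ?C (cover_map x)" if x: "x \<in> darts \<Gamma>" for x
  proof -
    obtain X g where X: "X \<in> darts Q" "g \<in> G" "x = g (\<tau> X)"
      using x elems_eq_act_rep(2) by auto
    have "beg \<Gamma> x = g (\<tau> (beg Q X))"
      using act_beg rep_darts beg_rep X by simp
    \<comment> \<open>Here the voltage enters: taking inverses changes the coset label from
      \<open>g\<close> to the product of \<open>\<zeta> X\<close> and \<open>g\<close>, as in
      \<open>gen_cover\<close>.\<close>
    moreover have "dinv \<Gamma> x = (\<zeta> X \<otimes>\<^bsub>A\<^esub> g) (\<tau> (dinv Q X))"
      using act_dinv rep_darts Q.dinv_closed zeta_rep act_mult X by simp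
    ultimately show ?thesis
      using X V.beg_gen_cover[of X g] V.dinv_gen_cover[of X g] cover_map_act_rep
        Q.beg_closed Q.dinv_closed mult_closed zeta_in by simp
  qed
  ultimately show ?thesis
    using V D by (simp add: graph_iso_def graph_hom_def)
qed

end

section \<open>Existence of compatible representatives\<close>

text \<open>Vertices are chosen first, by \<open>\<sigma>\<close>, and then darts, by
  \<open>\<rho>\<close>, among those that begin at the chosen vertices.\<close>

lemma (in graph_action) exists_orbit_representatives:
  obtains \<tau> where "orbit_representatives \<Gamma> G \<tau>"
proof -
  obtain \<sigma> where \<sigma>: "\<sigma> X \<in> X" if "X \<in> verts Q" for X
  proof
    fix X assume "X \<in> verts Q"
    then have "\<exists>v. v \<in> X" using orb_self by (auto simp: quotient_graph_def)
    then show "(SOME v. v \<in> X) \<in> X" by (rule someI_ex)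
  qed
  \<comment> \<open>As a set, \<open>beg Q X\<close> is the image of \<open>X\<close> under
    \<open>beg \<Gamma>\<close>, so each of its members is the beginning of a dart in
    \<open>X\<close>.\<close>
  have "\<exists>x\<in>X. beg \<Gamma> x = \<sigma> (beg Q X)" if "X \<in> darts Q" for X
    using \<sigma>[OF Q.beg_closed[OF that]] by (auto simp: quotient_graph_def)
  then obtain \<rho> where \<rho>: "\<rho> X \<in> X" "beg \<Gamma> (\<rho> X) = \<sigma> (beg Q X)" if "X \<in> darts Q" for X
    by metis
  \<comment> \<open>Vertex orbits are never dart orbits, so the two choices merge without
    conflict.\<close>
  have "orbit_representatives \<Gamma> G (\<lambda>X. if X \<in> darts Q then \<rho> X else \<sigma> X)"
    using \<sigma> \<rho> Q.beg_closed Q.verts_darts_disjoint by unfold_locales (auto simp: disjoint_iff)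
  then show thesis using that by blast
qed

theorem theorem4:
  fixes \<Gamma> :: "'a pregraph" and G :: "('a \<Rightarrow> 'a) set"
  assumes "graph \<Gamma>"
    and "subgroup G (Aut \<Gamma>)"
    and "connected_graph (quotient_graph \<Gamma> G)"
  shows "\<exists>(\<zeta> :: 'a set \<Rightarrow> 'a \<Rightarrow> 'a) (\<omega> :: 'a set \<Rightarrow> ('a \<Rightarrow> 'a) set).
    gen_voltage_graph (quotient_graph \<Gamma> G) (Aut \<Gamma>\<lparr>carrier := G\<rparr>) \<omega> \<zeta> \<and>
    graph_isomorphic \<Gamma> (gen_cover (quotient_graph \<Gamma> G) (Aut \<Gamma>\<lparr>carrier := G\<rparr>) \<omega> \<zeta>)"
proof -
  interpret graph_action \<Gamma> G
    using assms(1,2) by (simp add: graph_action_def graph_action_axioms_def)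
  obtain \<tau> where "orbit_representatives \<Gamma> G \<tau>"
    by (rule exists_orbit_representatives)
  then interpret orbit_representatives \<Gamma> G \<tau> .
  show ?thesis
    using gen_voltage_graph_quotient cover_map_iso assms(3) unfolding graph_isomorphic_def by blast
qed

end
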